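(* Let $K$ be an algebraically closed field of characteristic two. Any cubic rational expression $R(x)$ over $K$ is equivalent to either $x^3$, or $x^3+x^2$, or $(x^3+1)/x$, or $(x^3+cx^2)/(x+1)$ for some $c\in K\setminus\mathbb F_2$; in the last case the element $c$ is uniquely determined by $R(x)$ (i.e. distinct $c,c'\in K\setminus\mathbb F_2$ give inequivalent expressions).
   Context: A rational expression $R(x)=g(x)/h(x)\in K(x)$ with $g,h$ coprime has degree $\max(\deg g,\deg h)$; cubic means degree $3$. The group $G(K)=\mathrm{PGL}_2(K)\times\mathrm{PGL}_2(K)$, with $\mathrm{PGL}_2(K)$ identified with the group of degree-one rational expressions (Möbius transformations) under composition, acts on $K(x)$ by $(B,A)\cdot R(x)=B(R(A^{-1}(x)))$; two rational expressions are equivalent if they lie in the same $G(K)$-orbit. *)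

theory Defs
  imports "HOL-Computational_Algebra.Computational_Algebra" "HOL-Algebra.Group_Action"
begin

section \<open>Rational expressions over a field\<close>

text \<open>The field \<open>K(x)\<close> of rational expressions is the fraction field \<^typ>\<open>'a poly fract\<close> of \<open>K[x]\<close>.\<close>

definition rat_const :: "'a::field \<Rightarrow> 'a poly fract" where
  "rat_const c = to_fract [:c:]"

definition rat_X :: "'a::field poly fract" where
  "rat_X = to_fract [:0, 1:]"

definition rat_degree :: "'a::field poly fract \<Rightarrow> nat" where
  "rat_degree R = (THE n. \<exists>g h. h \<noteq> 0 \<and> coprime g h \<and> R = Fract g h \<and> n = max (degree g) (degree h))"

definition poly_subst :: "'a::field poly \<Rightarrow> 'a poly fract \<Rightarrow> 'a poly fract" where
  "poly_subst p S = poly (map_poly rat_const p) S"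

text \<open>The composition \<open>R(S(x))\<close>. If \<open>S\<close> is a constant at which \<open>R\<close> has a pole, the value is \<open>0\<close>
  (division by zero); this case plays no role below, as all expressions composed are nonconstant.\<close>

definition rat_comp :: "'a::field poly fract \<Rightarrow> 'a poly fract \<Rightarrow> 'a poly fract" where
  "rat_comp R S =
    (THE T. \<exists>g h. h \<noteq> 0 \<and> coprime g h \<and> R = Fract g h \<and> T = poly_subst g S / poly_subst h S)"

definition PGL2 :: "'a::field poly fract monoid" where
  "PGL2 = \<lparr>carrier = {A. rat_degree A = 1}, mult = rat_comp, one = rat_X\<rparr>"

definition rat_act :: "'a::field poly fract \<times> 'a poly fract \<Rightarrow> 'a poly fract \<Rightarrow> 'a poly fract" where
  "rat_act = (\<lambda>(B, A) R. rat_comp B (rat_comp R (inv\<^bsub>PGL2\<^esub> A)))"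

definition rat_equiv :: "'a::field poly fract \<Rightarrow> 'a poly fract \<Rightarrow> bool" where
  "rat_equiv R S \<longleftrightarrow> S \<in> orbit (PGL2 \<times>\<times> PGL2) rat_act R"


section \<open>The definitions are well behaved\<close>

lemma poly_bezout:
  fixes a b :: "'a::field poly"
  assumes "coprime a b"
  shows "\<exists>u v. u * a + v * b = 1"
proof -
  define I where "I = {u * a + v * b | u v. True}"
  have I_diff: "p - q * r \<in> I" if pI: "p \<in> I" and rI: "r \<in> I" for p q r
  proof -
    obtain u v where p: "p = u * a + v * b" using pI by (auto simp: I_def)
    obtain u' v' where r: "r = u' * a + v' * b" using rI by (auto simp: I_def)
    have "p - q * r = (u - q * u') * a + (v - q * v') * b"
      unfolding p r by (simp add: algebra_simps)
    then show ?thesis unfolding I_def by blast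
  qed
  have aI: "a \<in> I" and bI: "b \<in> I"
  proof -
    have "a = 1 * a + 0 * b" "b = 0 * a + 1 * b" by simp_all
    then show "a \<in> I" "b \<in> I" unfolding I_def by blast+
  qed
  have "\<exists>d. d \<in> I \<and> d \<noteq> 0"
  proof (rule ccontr)
    assume "\<not> ?thesis"
    then have "a = 0" "b = 0" using aI bI by auto
    with assms show False by simp
  qed
  then obtain d where d: "d \<in> I" "d \<noteq> 0"
    and min: "\<And>p. p \<in> I \<Longrightarrow> p \<noteq> 0 \<Longrightarrow> degree d \<le> degree p"
    using ex_has_least_nat[of "\<lambda>d. d \<in> I \<and> d \<noteq> 0" _ degree] by blast
  have dvd: "d dvd p" if "p \<in> I" for p
  proof (rule ccontr)
    assume nd: "\<not> d dvd p"
    have "p mod d = p - p div d * d" by (simp add: minus_div_mult_eq_mod)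
    then have "p mod d \<in> I" using I_diff[OF that d(1)] by simp
    moreover have "p mod d \<noteq> 0" using nd by (simp add: dvd_eq_mod_eq_0)
    ultimately show False
      using min[of "p mod d"] degree_mod_less_degree[OF d(2) nd] by simp
  qed
  have "is_unit d" using assms dvd[OF aI] dvd[OF bI] by (meson coprime_common_divisor)
  then obtain e where e: "1 = d * e" by (rule dvdE)
  from d(1) obtain u v where "d = u * a + v * b" by (auto simp: I_def)
  with e have "(e * u) * a + (e * v) * b = 1" by (simp add: algebra_simps)
  then show ?thesis by blast
qed

lemma coprime_rep_unique:
  fixes g h g' h' :: "'a::field poly"
  assumes "h \<noteq> 0" "h' \<noteq> 0" "coprime g h" "coprime g' h'" "Fract g h = Fract g' h'"
  obtains k where "k \<noteq> 0" "g' = smult k g" "h' = smult k h"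
proof -
  have eq: "g * h' = g' * h" using assms by (simp add: eq_fract)
  obtain u v where uv: "u * g + v * h = 1" using poly_bezout[OF assms(3)] by blast
  obtain u' v' where uv': "u' * g' + v' * h' = 1" using poly_bezout[OF assms(4)] by blast
  define k where "k = u * g' + v * h'"
  have "h' = (u * g + v * h) * h'" using uv by simp
  also have "\<dots> = u * (g * h') + v * h * h'" by (simp add: algebra_simps)
  also have "\<dots> = k * h" unfolding eq k_def by (simp add: algebra_simps)
  finally have h': "h' = k * h" .
  have "g' * h = (k * g) * h" unfolding eq[symmetric] by (subst h') (simp only: mult_ac)
  then have g': "g' = k * g" using assms(1) by (metis mult_cancel_right)
  have "k * (u' * g + v' * h) = 1" using uv' unfolding g' h' by (simp add: algebra_simps)
  then have "is_unit k" by (metis dvd_triv_left)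
  then obtain c where "k = [:c:]" "c dvd 1" unfolding is_unit_poly_iff by blast
  then have c: "k = [:c:]" "c \<noteq> 0" by auto
  show thesis by (rule that[of c]) (use c g' h' in auto)
qed

lemma coprime_rep_exists:
  fixes R :: "'a::field poly fract"
  obtains g h where "h \<noteq> 0" "coprime g h" "R = Fract g h"
proof -
  obtain g0 h0 where "h0 \<noteq> 0" "R = Fract g0 h0" by (cases R) auto
  then obtain h where h: "h \<noteq> 0 \<and> (\<exists>g. R = Fract g h)"
    and min: "\<And>p. p \<noteq> 0 \<and> (\<exists>g. R = Fract g p) \<Longrightarrow> degree h \<le> degree p"
    using ex_has_least_nat[of "\<lambda>h. h \<noteq> 0 \<and> (\<exists>g. R = Fract g h)" h0 degree] by blast
  then obtain g where g: "R = Fract g h" by blast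
  have "coprime g h"
  proof (rule coprimeI)
    fix d assume "d dvd g" "d dvd h"
    then obtain g' h' where d: "g = d * g'" "h = d * h'" by (auto elim!: dvdE)
    with h have nz: "d \<noteq> 0" "h' \<noteq> 0" by auto
    have "R = Fract g' h'" using g nz unfolding d by (simp add: eq_fract)
    with min[of h'] nz have "degree h \<le> degree h'" by blast
    then have "degree d = 0" using nz unfolding d by (simp add: degree_mult_eq)
    with nz show "is_unit d" by (simp add: is_unit_iff_degree)
  qed
  with that h g show thesis by blast
qed

lemma rat_degree_Fract:
  fixes g h :: "'a::field poly"
  assumes "h \<noteq> 0" "coprime g h"
  shows "rat_degree (Fract g h) = max (degree g) (degree h)"
  unfolding rat_degree_def
proof (rule the_equality)
  fix n assume "\<exists>g' h'. h' \<noteq> 0 \<and> coprime g' h' \<and> Fract g h = Fract g' h' \<and> n = max (degree g') (degree h')"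
  then obtain g' h' where *: "h' \<noteq> 0" "coprime g' h'" "Fract g h = Fract g' h'"
    "n = max (degree g') (degree h')" by blast
  obtain k where "k \<noteq> 0" "g' = smult k g" "h' = smult k h"
    using coprime_rep_unique[OF assms(1) *(1) assms(2) *(2,3)] .
  with *(4) show "n = max (degree g) (degree h)" by simp
qed (use assms in blast)

lemma rat_const_hom:
  "rat_const 0 = 0" "rat_const 1 = 1" "rat_const (a + b) = rat_const a + rat_const b"
  "rat_const (a * b) = rat_const a * rat_const b" "rat_const a = 0 \<longleftrightarrow> a = 0"
  by (simp_all add: rat_const_def flip: to_fract_mult to_fract_add one_pCons)

lemma poly_subst_pCons: "poly_subst (pCons a p) S = rat_const a + S * poly_subst p S"
  by (simp add: poly_subst_def map_poly_pCons rat_const_hom)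

lemma poly_subst_0: "poly_subst 0 S = 0"
  by (simp add: poly_subst_def)

lemma poly_subst_smult: "poly_subst (smult c p) S = rat_const c * poly_subst p S"
  by (simp add: poly_subst_def map_poly_smult rat_const_hom)

lemma rat_comp_Fract:
  fixes g h :: "'a::field poly"
  assumes "h \<noteq> 0" "coprime g h"
  shows "rat_comp (Fract g h) S = poly_subst g S / poly_subst h S"
  unfolding rat_comp_def
proof (rule the_equality)
  fix T assume "\<exists>g' h'. h' \<noteq> 0 \<and> coprime g' h' \<and> Fract g h = Fract g' h' \<and> T = poly_subst g' S / poly_subst h' S"
  then obtain g' h' where *: "h' \<noteq> 0" "coprime g' h'" "Fract g h = Fract g' h'"
    "T = poly_subst g' S / poly_subst h' S" by blast
  obtain k where "k \<noteq> 0" "g' = smult k g" "h' = smult k h"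
    using coprime_rep_unique[OF assms(1) *(1) assms(2) *(2,3)] .
  with *(4) show "T = poly_subst g S / poly_subst h S"
    by (simp add: poly_subst_smult rat_const_hom)
qed (use assms in blast)

definition mobius :: "'a::field \<Rightarrow> 'a \<Rightarrow> 'a \<Rightarrow> 'a \<Rightarrow> 'a poly fract" where
  "mobius a b c d = Fract [:b, a:] [:d, c:]"

lemma mobius_coprime:
  fixes a b c d :: "'a::field"
  assumes "a * d - b * c \<noteq> 0"
  shows "coprime [:b, a:] [:d, c:]"
proof (rule coprimeI)
  fix p assume p: "p dvd [:b, a:]" "p dvd [:d, c:]"
  have "p dvd smult a [:d, c:] - smult c [:b, a:]" using p by (intro dvd_diff dvd_smult)
  also have "smult a [:d, c:] - smult c [:b, a:] = [:a * d - b * c:]" by (simp add: algebra_simps)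
  finally show "is_unit p" using assms dvd_trans is_unit_triv by blast
qed

lemma rat_degree_eq_1_iff:
  "rat_degree R = 1 \<longleftrightarrow> (\<exists>a b c d. a * d - b * c \<noteq> 0 \<and> R = mobius a b c d)"
proof
  assume deg: "rat_degree R = 1"
  obtain g h where gh: "h \<noteq> 0" "coprime g h" "R = Fract g h" by (rule coprime_rep_exists)
  with deg have max: "max (degree g) (degree h) = 1" by (simp add: rat_degree_Fract)
  then have "degree g \<le> 1" "degree h \<le> 1" by linarith+
  then have g: "g = [:coeff g 0, coeff g 1:]" and h: "h = [:coeff h 0, coeff h 1:]"
    by (auto intro!: poly_eqI simp: coeff_pCons coeff_eq_0 split: nat.splits)
  define a b c d where "a = coeff g 1" and "b = coeff g 0" and "c = coeff h 1" and "d = coeff h 0"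
  note gh' = g[folded this] h[folded this]
  have "a * d - b * c \<noteq> 0"
  proof
    assume det: "a * d - b * c = 0"
    have ac: "a \<noteq> 0 \<or> c \<noteq> 0" using max gh' by (auto split: if_splits)
    have "smult a h = smult c g" unfolding gh' using det by (simp add: algebra_simps)
    show False
    proof (cases "a = 0")
      case True
      with ac det have "b = 0" by simp
      with True gh' have "g = 0" by simp
      with gh(2) have "is_unit h" by simp
      then have "degree h = 0" by (simp only: is_unit_iff_degree[OF gh(1)])
      moreover have "degree h = 1" unfolding gh'(2) using ac True by simp
      ultimately show False by simp
    next
      case False
      have "g dvd smult a h" using \<open>smult a h = smult c g\<close> by (simp add: dvd_smult)
      with False have "g dvd h" by (simp add: dvd_smult_iff)
      with gh(2) have "is_unit g" using coprime_absorb_left by blast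
      with False gh' show False by (auto simp: is_unit_pCons_iff)
    qed
  qed
  moreover have "R = mobius a b c d" using gh(3) gh' by (simp add: mobius_def)
  ultimately show "\<exists>a b c d. a * d - b * c \<noteq> 0 \<and> R = mobius a b c d" by blast
next
  assume "\<exists>a b c d. a * d - b * c \<noteq> 0 \<and> R = mobius a b c d"
  then obtain a b c d where "a * d - b * c \<noteq> 0" "R = mobius a b c d" by blast
  moreover from this have "[:d, c:] \<noteq> 0" "max (degree [:b, a:]) (degree [:d, c:]) = 1" by auto
  ultimately show "rat_degree R = 1"
    unfolding mobius_def using rat_degree_Fract[OF _ mobius_coprime] by metis
qed

lemma rat_comp_mobius:
  assumes "a * d - b * c \<noteq> 0"
  shows "rat_comp (mobius a b c d) S =
    (rat_const a * S + rat_const b) / (rat_const c * S + rat_const d)"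
proof -
  have "[:d, c:] \<noteq> 0" using assms by auto
  then show ?thesis
    unfolding mobius_def using rat_comp_Fract[OF _ mobius_coprime[OF assms]]
    by (simp add: poly_subst_pCons poly_subst_0 algebra_simps)
qed

lemma rat_comp_mobius_mobius:
  assumes "a * d - b * c \<noteq> 0" "a' * d' - b' * c' \<noteq> 0"
  shows "rat_comp (mobius a b c d) (mobius a' b' c' d') =
    mobius (a * a' + b * c') (a * b' + b * d') (c * a' + d * c') (c * b' + d * d')"
proof -
  let ?q = "to_fract [:d', c':]" and ?p = "to_fract [:b', a':]"
  have q: "?q \<noteq> 0" using assms(2) by auto
  have "(rat_const a * (?p / ?q) + rat_const b) / (rat_const c * (?p / ?q) + rat_const d) =
    (rat_const a * ?p + rat_const b * ?q) / (rat_const c * ?p + rat_const d * ?q)"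
  proof -
    have "rat_const a * (?p / ?q) + rat_const b = (rat_const a * ?p + rat_const b * ?q) / ?q"
      "rat_const c * (?p / ?q) + rat_const d = (rat_const c * ?p + rat_const d * ?q) / ?q"
      using q by (simp_all add: field_simps)
    then show ?thesis using q by simp
  qed
  moreover have "mobius a' b' c' d' = ?p / ?q" by (simp add: mobius_def Fract_conv_to_fract)
  ultimately show ?thesis
    by (simp add: rat_comp_mobius[OF assms(1)])
      (simp add: mobius_def Fract_conv_to_fract rat_const_def algebra_simps
        flip: to_fract_mult to_fract_add)
qed

lemma rat_X_mobius: "rat_X = mobius 1 0 0 1"
  by (simp add: rat_X_def mobius_def to_fract_def one_pCons)

lemma mobius_scale:
  assumes "k \<noteq> 0" "a * d - b * c \<noteq> 0"
  shows "mobius (k * a) (k * b) (k * c) (k * d) = mobius a b c d"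
proof -
  have "[:d, c:] \<noteq> 0" using assms by auto
  then show ?thesis using assms(1) by (simp add: mobius_def eq_fract algebra_simps)
qed

lemma group_PGL2: "group (PGL2 :: 'a::field poly fract monoid)"
proof (rule groupI)
  have carrier: "A \<in> carrier PGL2 \<longleftrightarrow> (\<exists>a b c d. a * d - b * c \<noteq> 0 \<and> A = mobius a b c d)"
    for A :: "'a poly fract"
    using rat_degree_eq_1_iff[of A] by (simp add: PGL2_def)
  have det: "(a * a' + b * c') * (c * b' + d * d') - (a * b' + b * d') * (c * a' + d * c') \<noteq> 0"
    if "a * d - b * c \<noteq> 0" "a' * d' - b' * c' \<noteq> 0" for a b c d a' b' c' d' :: 'a
  proof -
    have "(a * a' + b * c') * (c * b' + d * d') - (a * b' + b * d') * (c * a' + d * c') =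
      (a * d - b * c) * (a' * d' - b' * c')" by (simp add: algebra_simps)
    then show ?thesis using that by simp
  qed
  show one: "\<one>\<^bsub>PGL2\<^esub> \<in> carrier (PGL2 :: 'a poly fract monoid)"
    unfolding carrier by (intro exI[of _ 1] exI[of _ 0]) (simp add: PGL2_def rat_X_mobius)
  fix A :: "'a poly fract" assume "A \<in> carrier PGL2"
  then obtain a b c d where A: "a * d - b * c \<noteq> 0" "A = mobius a b c d" by (auto simp: carrier)
  show "\<one>\<^bsub>PGL2\<^esub> \<otimes>\<^bsub>PGL2\<^esub> A = A"
    using A by (simp add: PGL2_def rat_X_mobius rat_comp_mobius_mobius)
  show "\<exists>B\<in>carrier PGL2. B \<otimes>\<^bsub>PGL2\<^esub> A = \<one>\<^bsub>PGL2\<^esub>"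
  proof
    have 1: "d * a - (- b) * (- c) \<noteq> 0" using A by (simp add: mult_ac)
    then show "mobius d (- b) (- c) a \<in> carrier PGL2" unfolding carrier by blast
    have "rat_comp (mobius d (- b) (- c) a) A = mobius (a * d - b * c) 0 0 (a * d - b * c)"
      unfolding A(2) rat_comp_mobius_mobius[OF 1 A(1)] by (simp add: algebra_simps)
    also have "\<dots> = mobius 1 0 0 1"
      using mobius_scale[OF A(1), of 1 1 0 0] by simp
    finally show "mobius d (- b) (- c) a \<otimes>\<^bsub>PGL2\<^esub> A = \<one>\<^bsub>PGL2\<^esub>"
      by (simp add: PGL2_def rat_X_mobius)
  qed
  fix B :: "'a poly fract" assume "B \<in> carrier PGL2"
  then obtain a' b' c' d' where B: "a' * d' - b' * c' \<noteq> 0" "B = mobius a' b' c' d'"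
    by (auto simp: carrier)
  show "A \<otimes>\<^bsub>PGL2\<^esub> B \<in> carrier PGL2"
    unfolding carrier using det[OF A(1) B(1)]
    by (auto simp: PGL2_def A(2) B(2) rat_comp_mobius_mobius[OF A(1) B(1)])
  fix C :: "'a poly fract" assume "C \<in> carrier PGL2"
  then obtain a'' b'' c'' d'' where C: "a'' * d'' - b'' * c'' \<noteq> 0" "C = mobius a'' b'' c'' d''"
    by (auto simp: carrier)
  have entry: "(p * q + r * s) * t + (p * q' + r * s') * t' = p * (q * t + q' * t') + r * (s * t + s' * t')"
    for p q r s t q' s' t' :: 'a by (simp add: algebra_simps)
  show "A \<otimes>\<^bsub>PGL2\<^esub> B \<otimes>\<^bsub>PGL2\<^esub> C = A \<otimes>\<^bsub>PGL2\<^esub> (B \<otimes>\<^bsub>PGL2\<^esub> C)"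
    by (simp only: PGL2_def monoid.simps A(2) B(2) C(2)
        rat_comp_mobius_mobius[OF A(1) B(1)] rat_comp_mobius_mobius[OF B(1) C(1)]
        rat_comp_mobius_mobius[OF A(1) det[OF B(1) C(1)]]
        rat_comp_mobius_mobius[OF det[OF A(1) B(1)] C(1)] entry)
qed

end

theory Submission
  imports Defs
begin

text \<open>Moving a critical point (a zero of the Wronskian \<open>g' h - g h'\<close>) and its value to infinity turns
  \<open>R\<close> into a cubic polynomial divided by a polynomial of degree at most one. If the denominator is
  constant, a shift removes the linear term, since in characteristic two the substitution \<open>x + t\<close> changes
  the linear coefficient by \<open>t\<^sup>2\<close>. Otherwise \<open>R\<close> becomes \<open>x\<^sup>2 + a x + c / x\<close>, with derivative
  \<open>a + c / x\<^sup>2\<close>: if \<open>a = 0\<close> a scaling suffices, and if not, the only other critical point is moved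
  to \<open>0\<close>. In the last normal form \<open>0\<close> and infinity are the two critical points, and the
  remaining points of their fibres are \<open>c\<close> and \<open>1\<close>; a Moebius transformation fixing or swapping
  the two critical points can only preserve \<open>c\<close>.\<close>

section \<open>Substitution as a field homomorphism\<close>

lemma poly_subst_add: "poly_subst (p + q) S = poly_subst p S + poly_subst q S"
  by (induction p q rule: poly_induct2) (simp_all add: poly_subst_pCons poly_subst_0 rat_const_hom algebra_simps)

lemma poly_subst_mult: "poly_subst (p * q) S = poly_subst p S * poly_subst q S"
  by (induction p)
    (simp_all add: poly_subst_pCons poly_subst_0 poly_subst_add poly_subst_smult rat_const_hom algebra_simps)

lemma poly_subst_1: "poly_subst 1 S = 1"
  by (simp add: one_pCons poly_subst_pCons poly_subst_0 rat_const_hom)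

lemma rat_const_uminus: "rat_const (- a) = - rat_const a"
  by (metis add.right_inverse add_eq_0_iff rat_const_hom(1,3))

lemma rat_const_diff: "rat_const (a - b) = rat_const a - rat_const b"
  using rat_const_hom(3)[of a "- b"] by (simp add: rat_const_uminus)

lemma rat_const_inverse: "rat_const (inverse a) = inverse (rat_const a)"
  by (cases "a = 0")
    (auto simp: rat_const_hom intro!: inverse_unique[symmetric] simp flip: rat_const_hom(4))

lemma rat_const_divide: "rat_const (a / b) = rat_const a / rat_const b"
  by (simp add: divide_inverse rat_const_hom rat_const_inverse)

lemma rat_const_power: "rat_const (a ^ n) = rat_const a ^ n"
  by (induction n) (simp_all add: rat_const_hom)

lemma to_fract_pCons: "to_fract (pCons a p) = rat_const a + rat_X * to_fract p"
proof -
  have "pCons a p = [:a:] + [:0, 1:] * p" by simp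
  then show ?thesis unfolding rat_const_def rat_X_def by (metis to_fract_add to_fract_mult)
qed

text \<open>The elements of K(x) that are transcendental over K: substituting one of them never
  creates a zero denominator.\<close>

definition nonconst :: "'a::field poly fract \<Rightarrow> bool" where
  "nonconst S \<longleftrightarrow> S \<notin> range rat_const"

text \<open>Over an algebraically closed field \<open>p\<close> splits into linear factors, and none
  of them vanishes at a nonconstant \<open>S\<close>.\<close>

lemma poly_subst_nonzero:
  fixes S :: "'a::alg_closed_field poly fract"
  assumes "nonconst S" "p \<noteq> 0"
  shows "poly_subst p S \<noteq> 0"
proof -
  obtain A where p: "p = smult (lead_coeff p) (\<Prod>x\<in>#A. [:-x, 1:])"
    using alg_closed_imp_factorization[OF assms(2)] by blast
  have "poly_subst (\<Prod>x\<in>#A. [:-x, 1:]) S \<noteq> 0"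
  proof (induction A)
    case (add x A)
    have "S \<noteq> rat_const x" using assms(1) by (auto simp: nonconst_def)
    then have "poly_subst [:-x, 1:] S \<noteq> 0"
      by (simp add: poly_subst_pCons poly_subst_0 rat_const_hom rat_const_uminus)
    with add show ?case by (simp add: poly_subst_mult del: mult_pCons_left)
  qed (simp add: poly_subst_1)
  moreover have "rat_const (lead_coeff p) \<noteq> 0" using assms(2) by (simp add: rat_const_hom)
  ultimately show ?thesis by (subst p) (simp add: poly_subst_smult)
qed

context
  fixes S :: "'a::alg_closed_field poly fract"
  assumes S: "nonconst S"
begin

text \<open>Frees the computation of compositions from coprimality: cross-multiplication survives
  the substitution, and no denominator becomes zero.\<close>

lemma rat_comp_Fract_nonconst:
  assumes "h \<noteq> 0"
  shows "rat_comp (Fract g h) S = poly_subst g S / poly_subst h S"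
proof -
  obtain g' h' where *: "h' \<noteq> 0" "coprime g' h'" "Fract g h = Fract g' h'"
    by (rule coprime_rep_exists)
  have "g * h' = g' * h" using * assms by (simp add: eq_fract)
  then have "poly_subst g S * poly_subst h' S = poly_subst g' S * poly_subst h S"
    by (metis poly_subst_mult)
  then show ?thesis
    using * poly_subst_nonzero[OF S assms] poly_subst_nonzero[OF S *(1)]
    by (simp add: rat_comp_Fract frac_eq_eq)
qed

lemma rat_comp_const: "rat_comp (rat_const k) S = rat_const k"
  by (simp add: rat_const_def to_fract_def rat_comp_Fract_nonconst)
    (simp add: poly_subst_pCons poly_subst_0 poly_subst_1 rat_const_def to_fract_def)

lemma rat_comp_X: "rat_comp rat_X S = S"
  by (simp add: rat_X_def to_fract_def rat_comp_Fract_nonconst)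
    (simp add: poly_subst_pCons poly_subst_0 poly_subst_1 rat_const_hom)

lemma rat_comp_0: "rat_comp 0 S = 0"
  using rat_comp_const[of 0] by (simp add: rat_const_hom)

lemma rat_comp_1: "rat_comp 1 S = 1"
  using rat_comp_const[of 1] by (simp add: rat_const_hom)

lemma rat_comp_add: "rat_comp (P + Q) S = rat_comp P S + rat_comp Q S"
  by (cases P; cases Q)
    (simp add: rat_comp_Fract_nonconst poly_subst_add poly_subst_mult poly_subst_nonzero[OF S] add_frac_eq)

lemma rat_comp_mult: "rat_comp (P * Q) S = rat_comp P S * rat_comp Q S"
  by (cases P; cases Q) (simp add: rat_comp_Fract_nonconst poly_subst_mult)

lemma rat_comp_inverse: "rat_comp (inverse P) S = inverse (rat_comp P S)"
proof (cases "P = 0")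
  case False
  then have "rat_comp P S * rat_comp (inverse P) S = 1"
    using rat_comp_mult[of P "inverse P"] by (simp add: rat_comp_1)
  then show ?thesis by (simp add: inverse_unique)
qed (simp add: rat_comp_0)

lemma rat_comp_divide: "rat_comp (P / Q) S = rat_comp P S / rat_comp Q S"
  by (simp add: divide_inverse rat_comp_mult rat_comp_inverse)

lemma rat_comp_power: "rat_comp (P ^ n) S = rat_comp P S ^ n"
  by (induction n) (simp_all add: rat_comp_1 rat_comp_mult)

lemmas rat_comp_hom = rat_comp_const rat_comp_X rat_comp_0 rat_comp_1 rat_comp_add rat_comp_mult
  rat_comp_divide rat_comp_power

lemma rat_comp_eq_iff: "rat_comp P S = rat_comp Q S \<longleftrightarrow> P = Q"
proof -
  have 0: "P = 0" if "rat_comp P S = 0" for P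
  proof -
    obtain g h where gh: "h \<noteq> 0" "P = Fract g h" by (cases P) auto
    then have "poly_subst g S = 0"
      using that poly_subst_nonzero[OF S gh(1)] rat_comp_Fract_nonconst[OF gh(1), of g] by simp
    then have "g = 0" using poly_subst_nonzero[OF S] by blast
    with gh show ?thesis by (simp add: Fract_conv_to_fract)
  qed
  have "rat_comp (P - Q) S = rat_comp P S - rat_comp Q S"
    using rat_comp_add[of "P - Q" Q] by simp
  then show ?thesis using 0[of "P - Q"] by force
qed

lemma nonconst_rat_comp:
  assumes "nonconst R"
  shows "nonconst (rat_comp R S)"
  using assms rat_comp_eq_iff[of R "rat_const _", unfolded rat_comp_const]
  by (auto simp: nonconst_def)

text \<open>Substituting \<open>S\<close> is a homomorphism fixing the constants, so it passes
  through the Horner evaluation of numerator and denominator of \<open>R\<close> at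
  \<open>T\<close>.\<close>

lemma rat_comp_assoc:
  assumes "nonconst T"
  shows "rat_comp (rat_comp R T) S = rat_comp R (rat_comp T S)"
proof -
  have "rat_comp (poly_subst p T) S = poly_subst p (rat_comp T S)" for p
    by (induction p) (simp_all add: poly_subst_pCons poly_subst_0 rat_comp_hom)
  moreover obtain g h where "h \<noteq> 0" "coprime g h" "R = Fract g h" by (rule coprime_rep_exists)
  ultimately show ?thesis by (simp add: rat_comp_Fract rat_comp_divide)
qed

end

section \<open>Degree and equivalence\<close>

text \<open>Bounds the degree by means of any fraction, reduced or not: by Bezout, the reduced
  numerator and denominator divide those of every other representation.\<close>

lemma rat_degree_le_iff:
  "rat_degree R \<le> n \<longleftrightarrow> (\<exists>g h. h \<noteq> 0 \<and> degree g \<le> n \<and> degree h \<le> n \<and> R = Fract g h)"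
proof
  assume "rat_degree R \<le> n"
  moreover obtain g h where "h \<noteq> 0" "coprime g h" "R = Fract g h" by (rule coprime_rep_exists)
  ultimately show "\<exists>g h. h \<noteq> 0 \<and> degree g \<le> n \<and> degree h \<le> n \<and> R = Fract g h"
    by (auto simp: rat_degree_Fract)
next
  assume "\<exists>g h. h \<noteq> 0 \<and> degree g \<le> n \<and> degree h \<le> n \<and> R = Fract g h"
  then obtain g h where gh: "h \<noteq> 0" "degree g \<le> n" "degree h \<le> n" "R = Fract g h" by blast
  obtain g' h' where *: "h' \<noteq> 0" "coprime g' h'" "R = Fract g' h'" by (rule coprime_rep_exists)
  have eq: "g * h' = g' * h" using gh * by (simp add: eq_fract)
  obtain u v where uv: "u * g' + v * h' = 1" using poly_bezout[OF *(2)] by blast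
  \<comment> \<open>Multiplying the Bezout relation by \<open>h\<close> and applying
    \<open>eq\<close> exhibits \<open>h\<close> as a multiple of \<open>h'\<close>; below,
    \<open>g\<close> is treated in the same way.\<close>
  have "h = (u * g' + v * h') * h" by (simp add: uv)
  also have "\<dots> = u * (g' * h) + v * h' * h" by (simp add: algebra_simps)
  also have "\<dots> = h' * (u * g + v * h)" by (simp add: algebra_simps flip: eq)
  finally have "h' dvd h" by (rule dvdI)
  then have "degree h' \<le> n" using gh by (meson dvd_imp_degree_le le_trans)
  moreover have "degree g' \<le> n"
  proof (cases "g = 0")
    case True
    with eq gh have "g' = 0" by simp
    then show ?thesis by simp
  next
    case False
    have "g = (u * g' + v * h') * g" by (simp add: uv)
    also have "\<dots> = u * g' * g + v * (g * h')" by (simp add: algebra_simps)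
    also have "\<dots> = g' * (u * g + v * h)" by (simp add: algebra_simps eq)
    finally have "g' dvd g" by (rule dvdI)
    then show ?thesis using gh False by (meson dvd_imp_degree_le le_trans)
  qed
  ultimately show "rat_degree R \<le> n" using * by (simp add: rat_degree_Fract)
qed

lemma nonconst_iff_degree: "nonconst R \<longleftrightarrow> rat_degree R > 0"
proof -
  have "rat_degree R \<le> 0 \<longleftrightarrow> R \<in> range rat_const"
  proof
    assume "rat_degree R \<le> 0"
    then obtain g h where gh: "h \<noteq> 0" "degree g \<le> 0" "degree h \<le> 0" "R = Fract g h"
      unfolding rat_degree_le_iff by blast
    then obtain a b where ab: "g = [:a:]" "h = [:b:]" by (metis degree_eq_zeroE le_zero_eq)
    have "R = rat_const a / rat_const b"
      using gh ab by (simp add: rat_const_def Fract_conv_to_fract)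
    then show "R \<in> range rat_const" by (simp flip: rat_const_divide)
  next
    assume "R \<in> range rat_const"
    then obtain a where "R = Fract [:a:] 1" by (auto simp: rat_const_def to_fract_def)
    then show "rat_degree R \<le> 0" unfolding rat_degree_le_iff by (intro exI[of _ "[:a:]"] exI[of _ 1]) simp
  qed
  then show ?thesis by (auto simp: nonconst_def)
qed

text \<open>Homogenisation: each Horner step costs one more factor \<open>v\<close> and raises the
  degree by at most one. As \<open>n\<close> may exceed the degree of \<open>p\<close>, numerator
  and denominator of an expression can be cleared by the same power of \<open>v\<close>.\<close>

lemma poly_subst_clear_denominator:
  fixes p :: "'a::field poly"
  assumes "degree p \<le> n" "v \<noteq> 0" "degree u \<le> 1" "degree v \<le> 1"
  shows "\<exists>q. degree q \<le> n \<and> poly_subst p (Fract u v) * to_fract v ^ n = to_fract q"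
  using assms(1)
proof (induction n arbitrary: p)
  case 0
  then obtain k where "p = [:k:]" by (metis degree_eq_zeroE le_zero_eq)
  then show ?case
    by (intro exI[of _ "[:k:]"]) (simp add: poly_subst_pCons poly_subst_0 rat_const_def)
next
  case (Suc n)
  obtain k p' where p: "p = pCons k p'" by (cases p)
  with Suc.prems have "degree p' \<le> n" by (cases "p' = 0") auto
  from Suc.IH[OF this] obtain q where q: "degree q \<le> n"
    "poly_subst p' (Fract u v) * to_fract v ^ n = to_fract q" by blast
  have "degree (v ^ Suc n) \<le> Suc n"
    using degree_power_le[of v "Suc n"] mult_le_mono1[OF assms(4), of "Suc n"]
    by (simp only: mult_1)
  then have "degree (smult k (v ^ Suc n)) \<le> Suc n" by (meson degree_smult_le le_trans)
  moreover have "degree (u * q) \<le> Suc n"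
    using degree_mult_le[of u q] q(1) assms(3) by linarith
  ultimately have "degree (smult k (v ^ Suc n) + u * q) \<le> Suc n" by (rule degree_add_le)
  moreover have "poly_subst p (Fract u v) * to_fract v ^ Suc n = to_fract (smult k (v ^ Suc n) + u * q)"
  proof -
    have "to_fract v \<noteq> 0" using assms(2) by simp
    then have "poly_subst p (Fract u v) * to_fract v ^ Suc n
      = rat_const k * to_fract v ^ Suc n + to_fract u * (poly_subst p' (Fract u v) * to_fract v ^ n)"
      by (simp add: p poly_subst_pCons Fract_conv_to_fract field_simps)
    moreover have "to_fract (v ^ m) = to_fract v ^ m" for m by (induction m) (simp_all)
    moreover have "to_fract (smult k (v ^ Suc n)) = rat_const k * to_fract (v ^ Suc n)"
      unfolding rat_const_def to_fract_mult[symmetric] by simp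
    ultimately show ?thesis by (simp add: q(2))
  qed
  ultimately show ?case by blast
qed

lemma PGL2_iff_mobius:
  "A \<in> carrier PGL2 \<longleftrightarrow> (\<exists>a b c d. a * d - b * c \<noteq> 0 \<and> A = mobius a b c d)"
  using rat_degree_eq_1_iff[of A] by (simp add: PGL2_def)

lemma nonconst_PGL2: "A \<in> carrier PGL2 \<Longrightarrow> nonconst A"
  by (simp add: PGL2_def nonconst_iff_degree)

lemma rat_degree_comp_right_le:
  fixes R :: "'a::alg_closed_field poly fract"
  assumes A: "A \<in> carrier PGL2"
  shows "rat_degree (rat_comp R A) \<le> rat_degree R"
proof -
  obtain g h where gh: "h \<noteq> 0" "degree g \<le> rat_degree R" "degree h \<le> rat_degree R" "R = Fract g h"
    using rat_degree_le_iff by blast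
  obtain u v where uv: "v \<noteq> 0" "degree u \<le> 1" "degree v \<le> 1" "A = Fract u v"
    using rat_degree_le_iff[of A 1] A by (auto simp: PGL2_def)
  obtain q r where q: "degree q \<le> rat_degree R"
      "poly_subst g A * to_fract v ^ rat_degree R = to_fract q"
    and r: "degree r \<le> rat_degree R"
      "poly_subst h A * to_fract v ^ rat_degree R = to_fract r"
    using poly_subst_clear_denominator[OF gh(2) uv(1-3)]
      poly_subst_clear_denominator[OF gh(3) uv(1-3)] uv(4) by metis
  have "poly_subst h A \<noteq> 0" by (rule poly_subst_nonzero[OF nonconst_PGL2[OF A] gh(1)])
  then have "r \<noteq> 0" using r(2) uv(1) by auto
  moreover have "rat_comp R A = Fract q r"
    unfolding Fract_conv_to_fract[of q] q(2)[symmetric] r(2)[symmetric]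
    using rat_comp_Fract_nonconst[OF nonconst_PGL2[OF A] gh(1), of g] uv(1) gh(4) by simp
  ultimately show ?thesis using q(1) r(1) rat_degree_le_iff by blast
qed

text \<open>\<open>B\<close> replaces \<open>g\<close> and \<open>h\<close> by linear combinations
  of them, which cannot raise the degree; the new denominator is nonzero because \<open>R\<close> is
  not constant.\<close>

lemma rat_degree_comp_left_le:
  fixes R :: "'a::alg_closed_field poly fract"
  assumes B: "B \<in> carrier PGL2" and R: "nonconst R"
  shows "rat_degree (rat_comp B R) \<le> rat_degree R"
proof -
  obtain g h where gh: "h \<noteq> 0" "degree g \<le> rat_degree R" "degree h \<le> rat_degree R" "R = Fract g h"
    using rat_degree_le_iff by blast
  obtain a b c d where abcd: "a * d - b * c \<noteq> 0" "B = mobius a b c d"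
    using B by (auto simp: PGL2_iff_mobius)
  have "[:d, c:] \<noteq> 0" using abcd(1) by auto
  then have "poly_subst [:d, c:] R \<noteq> 0" by (rule poly_subst_nonzero[OF R])
  then have nz: "rat_const c * R + rat_const d \<noteq> 0"
    by (simp add: poly_subst_pCons poly_subst_0 algebra_simps)
  have frac: "rat_const k * R + rat_const l = to_fract (smult k g + smult l h) / to_fract h" for k l
  proof -
    have "smult k g + smult l h = [:k:] * g + [:l:] * h" by simp
    then have "to_fract (smult k g + smult l h) = rat_const k * to_fract g + rat_const l * to_fract h"
      unfolding rat_const_def by (metis to_fract_add to_fract_mult)
    then show ?thesis using gh(1,4) by (simp add: Fract_conv_to_fract field_simps)
  qed
  have "smult c g + smult d h \<noteq> 0" using nz unfolding frac by (metis div_0 to_fract_0)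
  moreover have "rat_comp B R = Fract (smult a g + smult b h) (smult c g + smult d h)"
    using gh(1) by (simp add: abcd(2) rat_comp_mobius[OF abcd(1)] frac Fract_conv_to_fract)
  moreover have "degree (smult k g + smult l h) \<le> rat_degree R" for k l
    using gh by (meson degree_add_le degree_smult_le le_trans)
  ultimately show ?thesis unfolding rat_degree_le_iff by blast
qed

section \<open>Equivalence as a relation, and invariance of the degree\<close>

lemma rat_equiv_iff:
  "rat_equiv R S \<longleftrightarrow> (\<exists>B\<in>carrier PGL2. \<exists>A\<in>carrier PGL2. S = rat_comp B (rat_comp R A))"
proof -
  interpret group PGL2 by (rule group_PGL2)
  have "rat_equiv R S \<longleftrightarrow>
      (\<exists>B\<in>carrier PGL2. \<exists>A\<in>carrier PGL2. S = rat_comp B (rat_comp R (inv\<^bsub>PGL2\<^esub> A)))"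
    by (auto simp: rat_equiv_def orbit_def rat_act_def DirProd_def)
  also have "\<dots> \<longleftrightarrow> (\<exists>B\<in>carrier PGL2. \<exists>A\<in>carrier PGL2. S = rat_comp B (rat_comp R A))"
  proof (intro bex_cong refl iffI; elim bexE)
    fix B A assume "A \<in> carrier PGL2" "S = rat_comp B (rat_comp R A)"
    then show "\<exists>A\<in>carrier PGL2. S = rat_comp B (rat_comp R (inv\<^bsub>PGL2\<^esub> A))"
      by (intro bexI[of _ "inv\<^bsub>PGL2\<^esub> A"]) auto
  qed auto
  finally show ?thesis .
qed

lemma rat_equiv_trans:
  fixes R :: "'a::alg_closed_field poly fract"
  assumes "nonconst R" "rat_equiv R S" "rat_equiv S T"
  shows "rat_equiv R T"
proof -
  interpret group "PGL2 :: 'a poly fract monoid" by (rule group_PGL2)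
  obtain B A where 1: "B \<in> carrier PGL2" "A \<in> carrier PGL2" "S = rat_comp B (rat_comp R A)"
    using assms(2) rat_equiv_iff by blast
  obtain B' A' where 2: "B' \<in> carrier PGL2" "A' \<in> carrier PGL2" "T = rat_comp B' (rat_comp S A')"
    using assms(3) rat_equiv_iff by blast
  note nc = 1(1,2)[THEN nonconst_PGL2] 2(1,2)[THEN nonconst_PGL2] assms(1)
  have "rat_comp B' B \<in> carrier PGL2" "rat_comp A A' \<in> carrier PGL2"
    using m_closed[OF 2(1) 1(1)] m_closed[OF 1(2) 2(2)] by (simp_all add: PGL2_def)
  moreover have "T = rat_comp (rat_comp B' B) (rat_comp R (rat_comp A A'))"
    unfolding 1(3) 2(3) using nc by (simp add: rat_comp_assoc nonconst_rat_comp)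
  ultimately show ?thesis unfolding rat_equiv_iff by blast
qed

lemma rat_comp_X_left: "rat_comp rat_X R = R"
  using rat_comp_mobius[of 1 1 0 0 R] by (simp add: rat_X_mobius rat_const_hom)

lemma rat_comp_X_right:
  fixes R :: "'a::alg_closed_field poly fract"
  shows "rat_comp R rat_X = R"
proof -
  have "poly_subst p rat_X = to_fract p" for p :: "'a poly"
    by (induction p) (simp_all add: poly_subst_pCons poly_subst_0 to_fract_pCons)
  moreover obtain g h where "h \<noteq> 0" "coprime g h" "R = Fract g h" by (rule coprime_rep_exists)
  ultimately show ?thesis by (simp add: rat_comp_Fract) (simp add: Fract_conv_to_fract)
qed

lemma rat_equiv_sym:
  fixes R :: "'a::alg_closed_field poly fract"
  assumes "nonconst R" "rat_equiv R S"
  shows "rat_equiv S R"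
proof -
  interpret group "PGL2 :: 'a poly fract monoid" by (rule group_PGL2)
  obtain B A where 1: "B \<in> carrier PGL2" "A \<in> carrier PGL2" "S = rat_comp B (rat_comp R A)"
    using assms(2) rat_equiv_iff by blast
  let ?B = "inv\<^bsub>PGL2\<^esub> B" and ?A = "inv\<^bsub>PGL2\<^esub> A"
  have 2: "?B \<in> carrier PGL2" "?A \<in> carrier PGL2" using 1 by auto
  note nc = 1(1,2)[THEN nonconst_PGL2] 2(1,2)[THEN nonconst_PGL2] assms(1)
  have "rat_comp ?B (rat_comp S ?A) = rat_comp (rat_comp ?B B) (rat_comp R (rat_comp A ?A))"
    unfolding 1(3) using nc by (simp add: rat_comp_assoc nonconst_rat_comp)
  also have "rat_comp ?B B = rat_X" using l_inv[OF 1(1)] by (simp add: PGL2_def)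
  also have "rat_comp A ?A = rat_X" using r_inv[OF 1(2)] by (simp add: PGL2_def)
  finally have "R = rat_comp ?B (rat_comp S ?A)" by (simp add: rat_comp_X_left rat_comp_X_right)
  with 2 show ?thesis unfolding rat_equiv_iff by blast
qed

lemma rat_X_PGL2: "rat_X \<in> carrier PGL2"
  using group.is_monoid[OF group_PGL2, THEN monoid.one_closed] by (simp add: PGL2_def)

text \<open>Neither composition raises the degree, and symmetry gives the reverse
  inequality.\<close>

lemma rat_equiv_degree:
  fixes R :: "'a::alg_closed_field poly fract"
  assumes "nonconst R" "rat_equiv R S"
  shows "rat_degree S = rat_degree R"
proof -
  have le: "rat_degree S \<le> rat_degree R \<and> nonconst S" if "nonconst R" "rat_equiv R S"
    for R S :: "'a poly fract"
  proof -
    obtain B A where BA: "B \<in> carrier PGL2" "A \<in> carrier PGL2" "S = rat_comp B (rat_comp R A)"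
      using \<open>rat_equiv R S\<close> rat_equiv_iff by blast
    have nc: "nonconst (rat_comp R A)" using BA(2) \<open>nonconst R\<close> by (simp add: nonconst_rat_comp nonconst_PGL2)
    show ?thesis
      using rat_degree_comp_left_le[OF BA(1) nc] rat_degree_comp_right_le[OF BA(2), of R]
        nonconst_rat_comp[OF nc nonconst_PGL2[OF BA(1)]] BA(3) by simp
  qed
  from le[OF assms] le[OF _ rat_equiv_sym[OF assms]] show ?thesis by simp
qed

lemma mobius_PGL2: "a * d - b * c \<noteq> 0 \<Longrightarrow> mobius a b c d \<in> carrier PGL2"
  by (auto simp: PGL2_iff_mobius)

lemma rat_equiv_mobius_left:
  fixes R :: "'a::alg_closed_field poly fract"
  assumes "a * d - b * c \<noteq> 0"
  shows "rat_equiv R ((rat_const a * R + rat_const b) / (rat_const c * R + rat_const d))"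
  unfolding rat_equiv_iff
  by (rule bexI[OF _ mobius_PGL2[OF assms]], rule bexI[OF _ rat_X_PGL2])
    (simp add: rat_comp_X_right rat_comp_mobius[OF assms])

lemma rat_equiv_comp:
  assumes "A \<in> carrier PGL2"
  shows "rat_equiv R (rat_comp R A)"
  unfolding rat_equiv_iff
  by (rule bexI[OF _ rat_X_PGL2], rule bexI[OF _ assms]) (simp add: rat_comp_X_left)

lemma mobius_conv:
  "mobius a b c d = (rat_const a * rat_X + rat_const b) / (rat_const c * rat_X + rat_const d)"
  by (simp add: mobius_def Fract_conv_to_fract to_fract_pCons algebra_simps)

text \<open>Reduces an equivalence to a single identity in K(x), with explicit Moebius maps as
  witnesses.\<close>

lemma rat_equivI:
  fixes R :: "'a::alg_closed_field poly fract"
  assumes "a * d - b * c \<noteq> 0" "p * s - q * r \<noteq> 0"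
    and "S = (rat_const a * rat_comp R (mobius p q r s) + rat_const b) /
      (rat_const c * rat_comp R (mobius p q r s) + rat_const d)"
  shows "rat_equiv R S"
  unfolding rat_equiv_iff
  using assms(3) rat_comp_mobius[OF assms(1)]
  by (intro bexI[OF _ mobius_PGL2[OF assms(1)]] bexI[OF _ mobius_PGL2[OF assms(2)]]) simp

lemma nonconst_mobius:
  fixes a b c d :: "'a::field"
  assumes "a * d - b * c \<noteq> 0"
  shows "nonconst (mobius a b c d)"
  by (rule nonconst_PGL2[OF mobius_PGL2[OF assms]])

lemma mobius_affine: "mobius a b 0 1 = rat_const a * rat_X + rat_const b"
  by (simp add: mobius_conv rat_const_hom)

section \<open>Reduction to normal form\<close>

definition cubic_normal_form :: "'a::field poly fract \<Rightarrow> bool" where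
  "cubic_normal_form S \<longleftrightarrow> S = rat_X ^ 3 \<or> S = rat_X ^ 3 + rat_X ^ 2 \<or> S = (rat_X ^ 3 + 1) / rat_X \<or>
    (\<exists>c. c \<notin> {0, 1} \<and> S = (rat_X ^ 3 + rat_const c * rat_X ^ 2) / (rat_X + 1))"

definition reducible_to_normal_form :: "'a::field poly fract \<Rightarrow> bool" where
  "reducible_to_normal_form R \<longleftrightarrow> (\<exists>S. cubic_normal_form S \<and> rat_equiv R S)"

lemma reducible_to_normal_form_trans:
  fixes R :: "'a::alg_closed_field poly fract"
  assumes "nonconst R" "rat_equiv R S" "reducible_to_normal_form S"
  shows "reducible_to_normal_form R"
  using assms rat_equiv_trans unfolding reducible_to_normal_form_def by blast

text \<open>Leading coefficients may vanish, so lower degrees are covered too: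
  \<open>cubic 0 0 p q\<close> has degree at most one.\<close>

definition cubic :: "'a::field \<Rightarrow> 'a \<Rightarrow> 'a \<Rightarrow> 'a \<Rightarrow> 'a poly fract" where
  "cubic a b c d = rat_const a * rat_X ^ 3 + rat_const b * rat_X ^ 2 + rat_const c * rat_X + rat_const d"

lemma cubic_to_fract: "cubic a b c d = to_fract [:d, c, b, a:]"
  by (simp add: cubic_def to_fract_pCons power3_eq_cube power2_eq_square algebra_simps)

lemma cubic_eq_0_iff: "cubic a b c d = 0 \<longleftrightarrow> a = 0 \<and> b = 0 \<and> c = 0 \<and> d = 0"
  by (auto simp: cubic_to_fract)

lemma rat_X_nonzero: "rat_X \<noteq> (0 :: 'a::field poly fract)" "rat_X + 1 \<noteq> (0 :: 'a poly fract)"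
  using cubic_eq_0_iff[of 0 0 1 0] cubic_eq_0_iff[of 0 0 1 1]
  by (simp_all add: cubic_def rat_const_hom)

lemma cubic_quotient_exists:
  assumes "rat_degree R \<le> 3"
  obtains a b c d a' b' c' d' where "cubic a' b' c' d' \<noteq> 0" "R = cubic a b c d / cubic a' b' c' d'"
proof -
  obtain g h where gh: "h \<noteq> 0" "degree g \<le> 3" "degree h \<le> 3" "R = Fract g h"
    using assms rat_degree_le_iff by blast
  have cubic: "to_fract p = cubic (coeff p 3) (coeff p 2) (coeff p 1) (coeff p 0)" if "degree p \<le> 3" for p :: "'a poly"
  proof -
    have "p = [:coeff p 0, coeff p 1, coeff p 2, coeff p 3:]"
      using that by (auto intro!: poly_eqI simp: coeff_pCons coeff_eq_0 numeral_eq_Suc split: nat.splits)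
    then show ?thesis unfolding cubic_to_fract by (rule arg_cong)
  qed
  from gh have "to_fract h \<noteq> 0" "R = to_fract g / to_fract h" by (simp_all add: Fract_conv_to_fract)
  with that show thesis unfolding cubic[OF gh(2)] cubic[OF gh(3)] by blast
qed

text \<open>Serves to exclude vanishing leading coefficients in quotients of degree three. A zero
  denominator gives the value 0.\<close>

lemma rat_degree_quadratic_quotient: "rat_degree (cubic 0 b c d / cubic 0 b' c' d') \<le> 2"
proof (cases "cubic 0 b' c' d' = 0")
  case True
  then show ?thesis
    unfolding rat_degree_le_iff by (intro exI[of _ 0] exI[of _ 1]) (simp add: Fract_conv_to_fract)
next
  case False
  have "cubic 0 b c d / cubic 0 b' c' d' = Fract [:d, c, b:] [:d', c', b':]"
    by (simp add: cubic_to_fract Fract_conv_to_fract)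
  moreover have "[:d', c', b':] \<noteq> 0" using False by (auto simp: cubic_eq_0_iff)
  moreover have "degree [:r, q, p:] \<le> 2" for p q r :: 'a by (simp add: numeral_2_eq_2)
  ultimately show ?thesis unfolding rat_degree_le_iff by blast
qed

section \<open>Reduction in characteristic two\<close>

context
  assumes char2: "CHAR('a::alg_closed_field) = 2"
begin

lemma two_eq_0: "(2 :: 'a) = 0"
  using of_nat_CHAR[where 'a = 'a] by (simp add: char2)

lemma fract_two_eq_0: "(2 :: 'a poly fract) = 0"
proof -
  have "(2 :: 'a poly fract) = rat_const 1 + rat_const 1" by (simp add: rat_const_hom)
  also have "\<dots> = rat_const 2" by (simp flip: rat_const_hom(3))
  finally show ?thesis by (simp add: two_eq_0 rat_const_hom)
qed

lemma fract_char2: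
  fixes x y :: "'a poly fract"
  shows "x + x = 0" "x + (x + y) = y" "- x = x" "(3 :: 'a poly fract) = 1"
proof -
  show "x + x = 0" using fract_two_eq_0 by (metis mult_2 mult_zero_left)
  then show "x + (x + y) = y" "- x = x"
    by (simp_all add: add.assoc[symmetric] add_eq_0_iff)
  show "(3 :: 'a poly fract) = 1" using fract_two_eq_0 by (metis add_0 one_plus_numeral add.commute semiring_norm(3))
qed

text \<open>After the shift by \<open>t\<close> the linear coefficient is
  \<open>3 * t ^ 2 + 2 * a * t + b\<close>, that is \<open>t ^ 2 + b\<close>, and the quadratic one
  is \<open>a + t\<close>. A square root of \<open>b\<close> removes the former; the latter, unless
  zero, is scaled to 1.\<close>

lemma reducible_monic_cubic:
  fixes a b e :: 'a
  shows "reducible_to_normal_form (cubic 1 a b e)"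
proof -
  obtain t where t: "t ^ 2 = b" using nth_root_exists[of 2 b] by auto
  define T A where "T = rat_const t" and "A = rat_const a"
  have T: "rat_const b = T ^ 2" by (simp add: T_def rat_const_power flip: t)
  show ?thesis
  proof (cases "a + t = 0")
    case True
    have "A = T" using True fract_char2(3)[of T]
      by (metis A_def T_def add_eq_0_iff2 rat_const_uminus)
    have "rat_equiv (cubic 1 a b e) (rat_X ^ 3)"
    proof (rule rat_equivI)
      show "rat_X ^ 3 = (rat_const 1 * rat_comp (cubic 1 a b e) (mobius 1 t 0 1)
          + rat_const (- (t ^ 3 + a * t ^ 2 + b * t + e))) /
        (rat_const 0 * rat_comp (cubic 1 a b e) (mobius 1 t 0 1) + rat_const 1)"
        unfolding cubic_def
        by (simp add: rat_comp_hom nonconst_mobius,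
            simp add: mobius_affine rat_const_hom rat_const_power rat_const_uminus rat_const_diff
              T flip: A_def T_def)
          (simp add: \<open>A = T\<close> power3_eq_cube power2_eq_square algebra_simps fract_char2)
    qed simp_all
    then show ?thesis by (auto simp: reducible_to_normal_form_def cubic_normal_form_def)
  next
    case False
    \<comment> \<open>Substituting \<open>u * x\<close> for x turns \<open>x ^ 3 + u * x ^ 2\<close>
      into \<open>u ^ 3\<close> times the normal form.\<close>
    define u where "u = a + t"
    define U where "U = rat_const u"
    have U: "U = A + T" by (simp add: U_def u_def A_def T_def rat_const_hom)
    have nz: "u \<noteq> 0" "U \<noteq> 0" using False by (simp_all add: u_def U_def rat_const_hom(5))
    have "rat_equiv (cubic 1 a b e) (rat_X ^ 3 + rat_X ^ 2)"
    proof (rule rat_equivI)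
      let ?R = "(U * rat_X + T) ^ 3 + A * (U * rat_X + T) ^ 2 + T ^ 2 * (U * rat_X + T) + rat_const e"
      let ?Z = "T ^ 3 + A * T ^ 2 + T ^ 2 * T + rat_const e"
      have "?R - ?Z = U ^ 3 * (rat_X ^ 3 + rat_X ^ 2)"
        unfolding U by (simp add: power3_eq_cube power2_eq_square algebra_simps fract_char2)
      then have "rat_X ^ 3 + rat_X ^ 2 = (?R - ?Z) / U ^ 3" using nz by simp
      also have "\<dots> = 1 / U ^ 3 * ?R + - ?Z / U ^ 3"
        unfolding diff_divide_distrib[of ?R] by (simp only: diff_conv_add_uminus minus_divide_left) simp
      finally have "rat_X ^ 3 + rat_X ^ 2 = 1 / U ^ 3 * ?R + - ?Z / U ^ 3" .
      then show "rat_X ^ 3 + rat_X ^ 2 = (rat_const (1 / u ^ 3) * rat_comp (cubic 1 a b e) (mobius u t 0 1)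
          + rat_const (- (t ^ 3 + a * t ^ 2 + b * t + e) / u ^ 3)) /
        (rat_const 0 * rat_comp (cubic 1 a b e) (mobius u t 0 1) + rat_const 1)"
        unfolding cubic_def using nz
        by (simp add: rat_comp_hom nonconst_mobius)
          (simp add: mobius_affine rat_const_hom rat_const_power rat_const_uminus
            rat_const_diff rat_const_divide T flip: A_def T_def U_def)
    qed (use nz in simp_all)
    then show ?thesis by (auto simp: reducible_to_normal_form_def cubic_normal_form_def)
  qed
qed

lemma reducible_cubic_over_X:
  fixes a c :: 'a
  assumes "c \<noteq> 0" "nonconst (cubic 1 a 0 c / rat_X)"
  shows "reducible_to_normal_form (cubic 1 a 0 c / rat_X)"
proof (cases "a = 0")
  case True
  \<comment> \<open>Substituting \<open>s * x\<close> in \<open>x ^ 2 + c / x\<close> gives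
    \<open>s ^ 2 * (x ^ 2 + 1 / x)\<close>.\<close>
  obtain s where s: "s ^ 3 = c" using nth_root_exists[of 3 c] by auto
  define Z where "Z = rat_const s"
  have nz: "s \<noteq> 0" "Z \<noteq> 0" using s assms(1) by (auto simp: Z_def rat_const_hom)
  have Z: "rat_const c = Z ^ 3" by (simp add: Z_def rat_const_power flip: s)
  have "rat_equiv (cubic 1 a 0 c / rat_X) ((rat_X ^ 3 + 1) / rat_X)"
  proof (rule rat_equivI)
    show "(rat_X ^ 3 + 1) / rat_X = (rat_const 1 * rat_comp (cubic 1 a 0 c / rat_X) (mobius s 0 0 1)
        + rat_const 0) / (rat_const 0 * rat_comp (cubic 1 a 0 c / rat_X) (mobius s 0 0 1) + rat_const (s ^ 2))"
      unfolding cubic_def True using nz rat_X_nonzero[where 'a = 'a]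
      by (simp add: rat_comp_hom nonconst_mobius,
          simp add: mobius_affine rat_const_hom rat_const_power Z flip: Z_def)
        (simp add: power3_eq_cube power2_eq_square field_simps)
  qed (use nz in simp_all)
  then show ?thesis by (auto simp: reducible_to_normal_form_def cubic_normal_form_def)
next
  case False
  \<comment> \<open>\<open>t\<close> is the second critical point, with critical value \<open>t\<^sup>2\<close>\<close>
  obtain t where t: "t ^ 2 = c / a" using nth_root_exists[of 2 "c / a"] by auto
  have c: "c = a * t ^ 2" using t False by simp
  \<comment> \<open>Substituting \<open>t * (x + 1)\<close> moves the critical point
    \<open>t\<close> to 0 and the pole 0 to 1. Subtracting the critical value and dividing by
    \<open>t ^ 2\<close> then leaves the numerator \<open>x ^ 3 + d * x ^ 2\<close> over
    \<open>x + 1\<close>.\<close>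
  define d where "d = 1 + a / t"
  let ?R = "cubic 1 a 0 c / rat_X" and ?S = "(rat_X ^ 3 + rat_const d * rat_X ^ 2) / (rat_X + 1)"
  define T A where "T = rat_const t" and "A = rat_const a"
  have nz: "t \<noteq> 0" "T \<noteq> 0" using c assms(1) by (auto simp: T_def rat_const_hom)
  have D: "rat_const d = 1 + A / T" by (simp add: d_def A_def T_def rat_const_hom rat_const_divide)
  have equiv: "rat_equiv ?R ?S"
  proof (rule rat_equivI)
    let ?Y = "rat_X + 1 :: 'a poly fract"
    have "(T * ?Y) ^ 3 + A * (T * ?Y) ^ 2 + A * T ^ 2 - T ^ 2 * (T * ?Y)
      = T ^ 2 * (T * rat_X ^ 3 + (T + A) * rat_X ^ 2)"
      by (simp add: power3_eq_cube power2_eq_square algebra_simps fract_char2)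
    moreover have "(x + (1 + A / T) * z) / y = T ^ 2 * (T * x + (T + A) * z) / (T * y * T ^ 2)" for x y z
      using nz by (cases "y = 0") (simp_all add: field_simps)
    ultimately have "?S = ((T * ?Y) ^ 3 + A * (T * ?Y) ^ 2 + A * T ^ 2 - T ^ 2 * (T * ?Y)) / (T * ?Y * T ^ 2)"
      by (simp only: D)
    also have "\<dots> = (((T * ?Y) ^ 3 + A * (T * ?Y) ^ 2 + A * T ^ 2) / (T * ?Y) - T ^ 2) / T ^ 2"
      using nz rat_X_nonzero[where 'a = 'a] by (simp add: diff_divide_distrib)
    finally show "?S = (rat_const 1 * rat_comp ?R (mobius t t 0 1) + rat_const (- (t ^ 2))) /
        (rat_const 0 * rat_comp ?R (mobius t t 0 1) + rat_const (t ^ 2))"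
      unfolding cubic_def c using nz
      by (simp add: rat_comp_hom nonconst_mobius)
        (simp add: mobius_affine rat_const_hom rat_const_power rat_const_uminus
          distrib_left flip: A_def T_def)
  qed (use nz in simp_all)
  have "d \<noteq> 1" using False nz by (simp add: d_def)
  show ?thesis
  proof (cases "d = 0")
    case True
    \<comment> \<open>For \<open>d = 0\<close> the expression is \<open>x ^ 3 / (x + 1)\<close>.
      Inverting both the variable and the value moves the triple zero at 0 to a triple pole at
      infinity and leaves a polynomial.\<close>
    have "rat_equiv ?S (rat_X ^ 3 + rat_X ^ 2)"
    proof (rule rat_equivI)
      let ?I = "mobius 0 1 1 0 :: 'a poly fract"
      show "rat_X ^ 3 + rat_X ^ 2 = (rat_const 0 * rat_comp ?S ?I + rat_const 1) /
          (rat_const 1 * rat_comp ?S ?I + rat_const 0)"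
        using rat_X_nonzero[where 'a = 'a]
        by (simp add: True rat_comp_hom nonconst_mobius rat_const_hom)
          (simp add: mobius_conv rat_const_hom field_simps power3_eq_cube power2_eq_square)
    qed simp_all
    with equiv have "rat_equiv ?R (rat_X ^ 3 + rat_X ^ 2)" using assms(2) rat_equiv_trans by blast
    then show ?thesis by (auto simp: reducible_to_normal_form_def cubic_normal_form_def)
  next
    case False
    with equiv \<open>d \<noteq> 1\<close> show ?thesis
      by (auto simp: reducible_to_normal_form_def cubic_normal_form_def)
  qed
qed

text \<open>A constant denominator leaves a cubic polynomial. Otherwise the root of the denominator
  is moved to 0; the linear term of the numerator then contributes a constant, which a translation
  of the values removes.\<close>

lemma reducible_cubic_over_linear:
  fixes a b c d p q :: 'a
  assumes deg: "rat_degree (cubic a b c d / cubic 0 0 p q) = 3"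
  shows "reducible_to_normal_form (cubic a b c d / cubic 0 0 p q)"
proof -
  let ?R = "cubic a b c d / cubic 0 0 p q"
  have nc: "nonconst ?R" using deg by (simp add: nonconst_iff_degree)
  have a: "a \<noteq> 0" using deg rat_degree_quadratic_quotient[of b c d 0 p q] by auto
  have nz: "rat_const a \<noteq> 0" using a by (simp add: rat_const_hom)
  show ?thesis
  proof (cases "p = 0")
    case True
    have "?R \<noteq> 0" using nc by (metis nonconst_def rat_const_hom(1) rangeI)
    \<comment> \<open>With \<open>p = q = 0\<close> the quotient would be 0 by division by zero,
      hence constant.\<close>
    then have q: "q \<noteq> 0" using True by (auto simp: cubic_def rat_const_hom)
    then have "rat_const q \<noteq> 0" by (simp add: rat_const_hom)
    have "rat_equiv ?R ((rat_const (q / a) * ?R + rat_const 0) / (rat_const 0 * ?R + rat_const 1))"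
      by (rule rat_equiv_mobius_left) (use a q in simp)
    also have "(rat_const (q / a) * ?R + rat_const 0) / (rat_const 0 * ?R + rat_const 1) =
        cubic 1 (b / a) (c / a) (d / a)"
      using nz \<open>rat_const q \<noteq> 0\<close> by (simp add: cubic_def True rat_const_hom rat_const_divide field_simps)
    finally show ?thesis
      using reducible_monic_cubic reducible_to_normal_form_trans[OF nc] by blast
  next
    case False
    define s where "s = q / p"
    \<comment> \<open>\<open>e\<close>, \<open>f\<close>, \<open>g\<close> are the lower
      coefficients of the numerator expanded around the root \<open>- s\<close> of the denominator,
      divided by \<open>a\<close>.\<close>
    define e where "e = (b - 3 * a * s) / a"
    define f where "f = (3 * a * s ^ 2 - 2 * b * s + c) / a"
    define g where "g = (- a * s ^ 3 + b * s ^ 2 - c * s + d) / a"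
    \<comment> \<open>Solving for the original coefficients makes the numerator identity below free
      of divisions.\<close>
    have coeffs: "b = a * (e + 3 * s)" "c = a * (f + 2 * s * (e + 3 * s) - 3 * s ^ 2)"
      "d = a * (g + s ^ 3 - s ^ 2 * (e + 3 * s) + s * (f + 2 * s * (e + 3 * s) - 3 * s ^ 2))"
      "q = p * s"
      using a False unfolding e_def f_def g_def s_def
      by (simp_all add: field_simps power2_eq_square power3_eq_cube)
    define A P S E F G where "A = rat_const a" and "P = rat_const p" and "S = rat_const s"
      and "E = rat_const e" and "F = rat_const f" and "G = rat_const g"
    note defs = this
    have nz: "A \<noteq> 0" "P \<noteq> 0" using a False by (simp_all add: defs rat_const_hom)
    have num: "rat_const 2 = (2 :: 'a poly fract)" "rat_const 3 = (3 :: 'a poly fract)"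
      using rat_const_hom(3)[of "1 :: 'a" 1] rat_const_hom(3)[of "2 :: 'a" 1] by (simp_all add: rat_const_hom)
    have equiv: "rat_equiv ?R (cubic 1 e 0 g / rat_X)"
    proof (rule rat_equivI)
      let ?Y = "rat_X - S"
      have "A * ?Y ^ 3 + A * (E + 3 * S) * ?Y ^ 2 + A * (F + 2 * S * (E + 3 * S) - 3 * S ^ 2) * ?Y
          + A * (G + S ^ 3 - S ^ 2 * (E + 3 * S) + S * (F + 2 * S * (E + 3 * S) - 3 * S ^ 2))
        = A * (rat_X ^ 3 + E * rat_X ^ 2 + F * rat_X + G)"
        by (simp add: power3_eq_cube power2_eq_square algebra_simps)
      then show "cubic 1 e 0 g / rat_X =
          (rat_const p * rat_comp ?R (mobius 1 (- s) 0 1) + rat_const (- a * f)) /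
          (rat_const 0 * rat_comp ?R (mobius 1 (- s) 0 1) + rat_const a)"
        unfolding cubic_def coeffs using nz rat_X_nonzero[where 'a = 'a]
        by (simp add: rat_comp_hom nonconst_mobius,
            simp add: mobius_affine rat_const_hom rat_const_power rat_const_uminus rat_const_diff num
              flip: defs)
          (simp add: field_simps)
    qed (use a False in simp_all)
    have "rat_degree (cubic 1 e 0 g / rat_X) = 3" using rat_equiv_degree[OF nc equiv] deg by simp
    \<comment> \<open>If \<open>g = 0\<close>, a factor x cancels and the degree drops.\<close>
    moreover have "rat_degree (cubic 1 e 0 g / rat_X) \<le> 2" if "g = 0"
    proof -
      have "cubic 1 e 0 g / rat_X = cubic 0 1 e 0 / cubic 0 0 0 1"
        using that rat_X_nonzero[where 'a = 'a]
        by (simp add: cubic_def rat_const_hom field_simps power3_eq_cube power2_eq_square)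
      then show ?thesis using rat_degree_quadratic_quotient[of 1 e 0 0 0 1] by simp
    qed
    ultimately have "g \<noteq> 0" "nonconst (cubic 1 e 0 g / rat_X)" by (auto simp: nonconst_iff_degree)
    then show ?thesis
      using reducible_cubic_over_X reducible_to_normal_form_trans[OF nc equiv] by blast
  qed
qed

text \<open>The hypothesis \<open>a q = b p\<close> says that the Wronskian, as a form of degree four, vanishes at
  infinity, so that infinity is a critical point.\<close>
lemma reducible_critical_at_infinity:
  fixes a b c d p q r s :: 'a
  assumes deg: "rat_degree (cubic a b c d / cubic p q r s) = 3"
    and critical: "a * q = b * p"
  shows "reducible_to_normal_form (cubic a b c d / cubic p q r s)"
proof -
  let ?R = "cubic a b c d / cubic p q r s"
  have nc: "nonconst ?R" using deg by (simp add: nonconst_iff_degree)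
  show ?thesis
  proof (cases "p = 0")
    case True
    have "a \<noteq> 0" using deg rat_degree_quadratic_quotient[of b c d q r s] True by auto
    with critical True have "q = 0" by simp
    with True show ?thesis using deg reducible_cubic_over_linear by simp
  next
    case False
    \<comment> \<open>\<open>k\<close> is the value at infinity, sent to infinity by
      \<open>1 / (y - k)\<close>. By the hypothesis both \<open>a - k * p\<close> and
      \<open>b - k * q\<close> vanish, so the new denominator has degree at most one.\<close>
    define k where "k = a / p"
    have k: "a = k * p" "b = k * q" using False critical by (simp_all add: k_def field_simps)
    have nz: "rat_const p \<noteq> 0" "cubic p q r s \<noteq> 0"
      using False by (simp_all add: rat_const_hom cubic_eq_0_iff)
    have "rat_equiv ?R ((rat_const 0 * ?R + rat_const 1) / (rat_const 1 * ?R + rat_const (- k)))"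
      by (rule rat_equiv_mobius_left) simp
    also have "(rat_const 0 * ?R + rat_const 1) / (rat_const 1 * ?R + rat_const (- k)) =
        cubic p q r s / cubic 0 0 (c - k * r) (d - k * s)"
    proof -
      have "cubic 0 0 (c - k * r) (d - k * s) = cubic (a - k * p) (b - k * q) (c - k * r) (d - k * s)"
        by (simp add: k)
      also have "\<dots> = cubic a b c d - rat_const k * cubic p q r s"
        by (simp add: cubic_def rat_const_hom rat_const_diff algebra_simps)
      finally have "?R + rat_const (- k) = cubic 0 0 (c - k * r) (d - k * s) / cubic p q r s"
        using nz by (simp add: rat_const_uminus diff_divide_distrib)
      then show ?thesis by (simp add: rat_const_hom)
    qed
    finally have equiv: "rat_equiv ?R (cubic p q r s / cubic 0 0 (c - k * r) (d - k * s))" .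
    with rat_equiv_degree[OF nc equiv] deg show ?thesis
      using reducible_cubic_over_linear reducible_to_normal_form_trans[OF nc] by simp
  qed
qed

text \<open>A critical point always exists: either the top coefficient \<open>a * q - b * p\<close>
  of the Wronskian vanishes and infinity is critical, or the Wronskian is a nonconstant polynomial
  with a root \<open>t\<close> in K, which \<open>t + 1 / x\<close> moves to infinity.\<close>

lemma reducible_degree_3:
  fixes R :: "'a poly fract"
  assumes deg: "rat_degree R = 3"
  shows "reducible_to_normal_form R"
proof -
  have nc: "nonconst R" using deg by (simp add: nonconst_iff_degree)
  obtain a b c d p q r s where R: "R = cubic a b c d / cubic p q r s"
    by (rule cubic_quotient_exists[of R]) (use deg in auto)
  show ?thesis
  proof (cases "a * q = b * p")
    case True
    then show ?thesis using reducible_critical_at_infinity deg R by blast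
  next
    case False
    \<comment> \<open>the Wronskian \<open>g' h - g h'\<close> of numerator and denominator\<close>
    define W where "W = [:c * s - d * r, 2 * (b * s - d * q), 3 * (a * s - d * p) + (b * r - c * q),
      2 * (a * r - c * p), a * q - b * p:]"
    have "degree W > 0" using False by (simp add: W_def)
    then obtain t where t: "poly W t = 0" using alg_closed_imp_poly_has_root by blast
    \<comment> \<open>\<open>num\<close> and \<open>der\<close> give the value and the derivative at
      \<open>t\<close>. They are the two top coefficients of \<open>x ^ 3 * f (t + 1 / x)\<close>
      for a cubic f, so the vanishing of the Wronskian at \<open>t\<close> becomes the criticality
      condition at infinity.\<close>
    define num where "num x y z w = x * t ^ 3 + y * t ^ 2 + z * t + w" for x y z w :: 'a
    define der where "der x y z = 3 * x * t ^ 2 + 2 * y * t + z" for x y z :: 'a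
    let ?S = "cubic (num a b c d) (der a b c) (3 * a * t + b) a /
      cubic (num p q r s) (der p q r) (3 * p * t + q) p"
    have "rat_equiv R (rat_comp R (mobius t 1 1 0))"
      by (rule rat_equiv_comp) (simp add: mobius_PGL2)
    also have "rat_comp R (mobius t 1 1 0) = ?S"
    proof -
      define T where "T = rat_const t"
      have num: "rat_const 2 = (2 :: 'a poly fract)" "rat_const 3 = (3 :: 'a poly fract)"
        using rat_const_hom(3)[of "1 :: 'a" 1] rat_const_hom(3)[of "2 :: 'a" 1] by (simp_all add: rat_const_hom)
      have "cubic (num x y z w) (der x y z) (3 * x * t + y) x = rat_X ^ 3 * rat_comp (cubic x y z w) (mobius t 1 1 0)"
        for x y z w
        unfolding cubic_def num_def der_def using rat_X_nonzero[where 'a = 'a]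
        by (simp add: rat_comp_hom nonconst_mobius,
            simp add: mobius_conv rat_const_hom rat_const_power num flip: T_def)
          (simp add: field_simps power3_eq_cube power2_eq_square)
      then show ?thesis
        using rat_X_nonzero[where 'a = 'a] by (simp add: R rat_comp_divide nonconst_mobius)
    qed
    finally have equiv: "rat_equiv R ?S" .
    have "num a b c d * der p q r = der a b c * num p q r s"
      using t unfolding W_def num_def der_def
      by (simp add: algebra_simps power3_eq_cube power2_eq_square)
    then have "reducible_to_normal_form ?S"
      using reducible_critical_at_infinity rat_equiv_degree[OF nc equiv] deg by simp
    then show ?thesis using reducible_to_normal_form_trans[OF nc equiv] by blast
  qed
qed

end

section \<open>Uniqueness of the parameter\<close>

text \<open>Cancelling a nonconstant common factor would push the degree below
  \<open>n\<close>.\<close>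

lemma coprime_if_rat_degree:
  fixes g h :: "'a::field poly"
  assumes h: "h \<noteq> 0" and deg: "degree g \<le> n" "degree h \<le> n" "rat_degree (Fract g h) = n"
  shows "coprime g h"
proof (rule coprimeI)
  fix d assume "d dvd g" "d dvd h"
  then obtain g' h' where d: "g = d * g'" "h = d * h'" by (auto elim!: dvdE)
  have nz: "d \<noteq> 0" "h' \<noteq> 0" using h d(2) by auto
  have "degree d = 0"
  proof (rule ccontr)
    assume *: "degree d \<noteq> 0"
    have "degree h' + degree d \<le> n" using deg(2) nz by (simp add: d(2) degree_mult_eq)
    moreover have "degree g' + degree d \<le> n"
      using deg(1) nz * \<open>degree h' + degree d \<le> n\<close> by (cases "g' = 0") (simp_all add: d(1) degree_mult_eq)
    moreover have "Fract g h = Fract g' h'" using nz by (simp add: d eq_fract)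
    ultimately have "rat_degree (Fract g h) \<le> n - degree d"
      unfolding rat_degree_le_iff using nz(2) by (intro exI[of _ g'] exI[of _ h']) auto
    with deg(3) * \<open>degree h' + degree d \<le> n\<close> show False by linarith
  qed
  with nz show "is_unit d" by (simp add: is_unit_iff_degree)
qed

text \<open>For \<open>c\<close> outside {0, 1}, the point 0 is a double zero and infinity a double
  pole; hence the name.\<close>

abbreviation (input) two_double_points :: "'a::field \<Rightarrow> 'a poly fract" where
  "two_double_points c \<equiv> (rat_X ^ 3 + rat_const c * rat_X ^ 2) / (rat_X + 1)"

text \<open>The four identities say that both \<open>u\<^sup>2 (u + c v)\<close> and \<open>v\<^sup>2 (u + v)\<close>, where
  \<open>u = \<alpha> x + \<beta>\<close> and \<open>v = \<gamma> x + \<delta>\<close>, lie in the span of \<open>x\<^sup>2 (x + c')\<close> and \<open>x + 1\<close>.\<close>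
lemma parameter_unique_aux:
  fixes \<alpha> \<beta> \<gamma> \<delta> c c' :: "'a::field"
  assumes det: "\<alpha> * \<delta> \<noteq> \<beta> * \<gamma>" and c: "c \<noteq> 1" "c' \<noteq> 1"
    and "\<alpha>\<^sup>2 * (\<beta> + c * \<delta>) = c' * (\<alpha>\<^sup>2 * (\<alpha> + c * \<gamma>))"
    and "\<beta>\<^sup>2 * (\<alpha> + c * \<gamma>) = \<beta>\<^sup>2 * (\<beta> + c * \<delta>)"
    and "\<gamma>\<^sup>2 * (\<beta> + \<delta>) = c' * (\<gamma>\<^sup>2 * (\<alpha> + \<gamma>))"
    and "\<delta>\<^sup>2 * (\<alpha> + \<gamma>) = \<delta>\<^sup>2 * (\<beta> + \<delta>)"
  shows "c = c'"
proof -
  \<comment> \<open>Each identity carries a square factor, so it yields either a vanishing entry or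
    a linear relation.\<close>
  have e: "\<alpha> = 0 \<or> \<beta> + c * \<delta> = c' * (\<alpha> + c * \<gamma>)" "\<beta> = 0 \<or> \<alpha> + c * \<gamma> = \<beta> + c * \<delta>"
    "\<gamma> = 0 \<or> \<beta> + \<delta> = c' * (\<alpha> + \<gamma>)" "\<delta> = 0 \<or> \<alpha> + \<gamma> = \<beta> + \<delta>"
    using assms(4-7) by (auto simp: mult.left_commute[of c'])
  show ?thesis
  proof (cases "\<beta> = 0")
    case True
    \<comment> \<open>Here the Moebius map fixes 0. The relations force it to fix infinity too, and
      \<open>\<alpha> = \<delta>\<close> then makes it the identity.\<close>
    with det have nz: "\<alpha> \<noteq> 0" "\<delta> \<noteq> 0" by auto
    with e True have 1: "\<alpha> + \<gamma> = \<delta>" "c * \<delta> = c' * (\<alpha> + c * \<gamma>)" by auto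
    have "\<gamma> = 0"
    proof (rule ccontr)
      assume "\<gamma> \<noteq> 0"
      with e(3) True 1(1) have "\<delta> = c' * \<delta>" by simp
      with nz c(2) show False by simp
    qed
    with 1 nz show ?thesis by simp
  next
    case False
    \<comment> \<open>Here 0 is not fixed. The relations force \<open>\<delta> = 0\<close> and
      \<open>\<alpha> = 0\<close>, so that the map swaps 0 and infinity.\<close>
    with e(2) have 1: "\<alpha> + c * \<gamma> = \<beta> + c * \<delta>" by simp
    have "\<delta> = 0"
    proof (rule ccontr)
      assume "\<delta> \<noteq> 0"
      with e(4) have 2: "\<alpha> + \<gamma> = \<beta> + \<delta>" by simp
      have "(c - 1) * (\<gamma> - \<delta>) = (\<alpha> + c * \<gamma> - (\<beta> + c * \<delta>)) - (\<alpha> + \<gamma> - (\<beta> + \<delta>))"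
        by (simp add: algebra_simps)
      then have "\<gamma> = \<delta>" using 1 2 c(1) by simp
      with 2 have "\<alpha> = \<beta>" by simp
      with \<open>\<gamma> = \<delta>\<close> det show False by simp
    qed
    with det have "\<gamma> \<noteq> 0" by auto
    with e(3) \<open>\<delta> = 0\<close> have 3: "\<beta> = c' * (\<alpha> + \<gamma>)" by simp
    have "\<alpha> = 0"
    proof (rule ccontr)
      assume "\<alpha> \<noteq> 0"
      with e(1) \<open>\<delta> = 0\<close> 1 have "\<beta> = c' * \<beta>" by simp
      with False c(2) show False by simp
    qed
    with 1 3 \<open>\<delta> = 0\<close> \<open>\<gamma> \<noteq> 0\<close> show ?thesis by simp
  qed
qed

text \<open>Squaring is additive in characteristic two, so the cross terms disappear. This produces
  the square factors in \<open>parameter_unique_aux\<close>.\<close>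

lemma coeffs_cubic_char2:
  fixes a b c d :: "'a::alg_closed_field"
  assumes "CHAR('a) = 2"
  shows "[:b, a:] ^ 2 * [:d, c:] = [:b\<^sup>2 * d, b\<^sup>2 * c, a\<^sup>2 * d, a\<^sup>2 * c:]"
proof -
  have "[:b, a:] ^ 2 * [:d, c:] = [:b\<^sup>2 * d, b\<^sup>2 * c + 2 * (a * b * d), a\<^sup>2 * d + 2 * (a * b * c), a\<^sup>2 * c:]"
    by (simp add: power2_eq_square algebra_simps)
  then show ?thesis by (simp add: two_eq_0[OF assms])
qed

text \<open>Composing with \<open>A\<close>, written as u / v, turns numerator and denominator into
  \<open>u ^ 2 * (u + c * v)\<close> and \<open>v ^ 2 * (u + v)\<close>. As \<open>B\<close> only
  forms invertible linear combinations, both lie in the span of \<open>x ^ 3 + c' * x ^ 2\<close>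
  and \<open>x + 1\<close>, and their coefficients satisfy the identities of
  \<open>parameter_unique_aux\<close>.\<close>

lemma parameter_unique:
  fixes c c' :: "'a::alg_closed_field"
  assumes char2: "CHAR('a) = 2" and c: "c \<noteq> 1" "c' \<noteq> 1"
    and equiv: "rat_equiv (two_double_points c) (two_double_points c')"
    and deg: "rat_degree (two_double_points c') = 3"
  shows "c = c'"
proof -
  obtain B A where BA: "B \<in> carrier PGL2" "A \<in> carrier PGL2"
    "two_double_points c' = rat_comp B (rat_comp (two_double_points c) A)"
    using equiv rat_equiv_iff by blast
  obtain p q r s where B: "p * s - q * r \<noteq> 0" "B = mobius p q r s"
    using BA(1) by (auto simp: PGL2_iff_mobius)
  obtain \<alpha> \<beta> \<gamma> \<delta> where A: "\<alpha> * \<delta> - \<beta> * \<gamma> \<noteq> 0" "A = mobius \<alpha> \<beta> \<gamma> \<delta>"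
    using BA(2) by (auto simp: PGL2_iff_mobius)
  define N where "N = [:\<beta>, \<alpha>:] ^ 2 * [:\<beta> + c * \<delta>, \<alpha> + c * \<gamma>:]"
  define D where "D = [:\<delta>, \<gamma>:] ^ 2 * [:\<beta> + \<delta>, \<alpha> + \<gamma>:]"
  define N' where "N' = [:0, 0, c', 1:]"
  define D' where "D' = [:1, 1:: 'a:]"
  note N = N_def[unfolded coeffs_cubic_char2[OF char2]] and D = D_def[unfolded coeffs_cubic_char2[OF char2]]
  have nz: "[:\<delta>, \<gamma>:] \<noteq> 0" "[:\<beta> + \<delta>, \<alpha> + \<gamma>:] \<noteq> 0"
    using A(1) by (auto simp: add_eq_0_iff)
  have "D \<noteq> 0" using nz unfolding D_def by (simp del: mult_pCons_left mult_pCons_right pCons_eq_0_iff)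
  have 1: "two_double_points c' = Fract N' D'"
    by (simp add: N'_def D'_def Fract_conv_to_fract to_fract_pCons rat_const_hom power2_eq_square
        power3_eq_cube algebra_simps)
  have "rat_comp (two_double_points c) A = to_fract N / to_fract D"
  proof -
    define U V where "U = to_fract [:\<beta>, \<alpha>:]" and "V = to_fract [:\<delta>, \<gamma>:]"
    have "V \<noteq> 0" using nz(1) by (simp add: V_def del: pCons_eq_0_iff)
    have A': "A = U / V" by (simp add: A(2) U_def V_def mobius_def Fract_conv_to_fract)
    have "to_fract [:\<beta> + c * \<delta>, \<alpha> + c * \<gamma>:] = U + rat_const c * V"
      "to_fract [:\<beta> + \<delta>, \<alpha> + \<gamma>:] = U + V"
      by (simp_all add: U_def V_def to_fract_pCons rat_const_hom algebra_simps)
    then have ND: "to_fract N = U ^ 2 * (U + rat_const c * V)" "to_fract D = V ^ 2 * (U + V)"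
      by (simp_all add: N_def D_def power2_eq_square U_def V_def del: mult_pCons_left mult_pCons_right)
    have "U + V \<noteq> 0" using ND(2) \<open>D \<noteq> 0\<close> by auto
    then have "(U / V) ^ 3 + rat_const c * (U / V) ^ 2 = to_fract N / V ^ 3" "U / V + 1 = (U + V) / V"
      using \<open>V \<noteq> 0\<close> unfolding ND by (simp_all add: field_simps power2_eq_square power3_eq_cube)
    then have "((U / V) ^ 3 + rat_const c * (U / V) ^ 2) / (U / V + 1) = to_fract N / to_fract D"
      using \<open>V \<noteq> 0\<close> \<open>U + V \<noteq> 0\<close>
      by (simp only: ND(2)) (simp add: power2_eq_square power3_eq_cube)
    moreover have "rat_comp (two_double_points c) A = (A ^ 3 + rat_const c * A ^ 2) / (A + 1)"
      using nonconst_PGL2[OF BA(2)] by (simp add: rat_comp_hom)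
    ultimately show ?thesis by (simp only: A')
  qed
  then have "two_double_points c' = (rat_const p * (to_fract N / to_fract D) + rat_const q) /
      (rat_const r * (to_fract N / to_fract D) + rat_const s)"
    unfolding BA(3) B(2) rat_comp_mobius[OF B(1)] by simp
  moreover have "rat_const x * (to_fract N / to_fract D) + rat_const y = to_fract (smult x N + smult y D) / to_fract D"
    for x y
  proof -
    have "smult x N + smult y D = [:x:] * N + [:y:] * D" by simp
    then have "to_fract (smult x N + smult y D) = rat_const x * to_fract N + rat_const y * to_fract D"
      unfolding rat_const_def by (metis to_fract_add to_fract_mult)
    then show ?thesis using \<open>D \<noteq> 0\<close> by (simp add: add_divide_distrib)
  qed
  ultimately have 2: "two_double_points c' = Fract (smult p N + smult q D) (smult r N + smult s D)"
    using \<open>D \<noteq> 0\<close> by (simp add: Fract_conv_to_fract)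
  \<comment> \<open>A zero denominator would give the constant 0 by division by zero, against degree
    three.\<close>
  have "smult r N + smult s D \<noteq> 0"
  proof
    assume "smult r N + smult s D = 0"
    then have "rat_degree (two_double_points c') \<le> 0"
      unfolding 2 rat_degree_le_iff by (intro exI[of _ 0] exI[of _ 1]) (simp add: Fract_conv_to_fract)
    with deg show False by simp
  qed
  moreover have "degree (smult x N + smult y D) \<le> 3" for x y
    by (simp add: N D)
  moreover have "degree N' \<le> 3" "degree D' \<le> 3" "D' \<noteq> 0" by (simp_all add: N'_def D'_def)
  \<comment> \<open>Both fractions attain the degree bound three, so both are reduced and differ by
    a constant factor.\<close>
  ultimately obtain k where k: "k \<noteq> 0" "smult p N + smult q D = smult k N'" "smult r N + smult s D = smult k D'"
    using coprime_rep_unique[of D' "smult r N + smult s D" N' "smult p N + smult q D"]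
      coprime_if_rat_degree[of _ _ 3] deg 1 2 by metis
  \<comment> \<open>The adjugate of the matrix of \<open>B\<close> solves for \<open>N\<close> and
    \<open>D\<close>.\<close>
  have "smult (p * s - q * r) N = smult s (smult p N + smult q D) - smult q (smult r N + smult s D)"
    "smult (p * s - q * r) D = smult p (smult r N + smult s D) - smult r (smult p N + smult q D)"
    by (simp_all add: algebra_simps smult_add_right smult_diff_left)
  then have "smult (p * s - q * r) N = smult (s * k) N' - smult (q * k) D'"
    "smult (p * s - q * r) D = smult (p * k) D' - smult (r * k) N'"
    by (simp_all add: k)
  \<comment> \<open>\<open>N'\<close> and \<open>D'\<close> both satisfy these two linear equations,
    hence so does every combination of them.\<close>
  moreover have "coeff P 2 = c' * coeff P 3 \<and> coeff P 1 = coeff P 0"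
    if "smult (p * s - q * r) P = smult x N' + smult y D'" for P x y
  proof -
    have "(p * s - q * r) * coeff P i = x * coeff N' i + y * coeff D' i" for i
      using arg_cong[OF that, of "\<lambda>P. coeff P i"] by simp
    from this[of 0] this[of 1] this[of 2] this[of 3]
    have "(p * s - q * r) * coeff P 2 = (p * s - q * r) * (c' * coeff P 3)"
      "(p * s - q * r) * coeff P 1 = (p * s - q * r) * coeff P 0"
      by (simp_all add: N'_def D'_def numeral_eq_Suc mult.left_commute)
    with B(1) show ?thesis by (metis mult_cancel_left)
  qed
  ultimately have "coeff N 2 = c' * coeff N 3 \<and> coeff N 1 = coeff N 0"
    "coeff D 2 = c' * coeff D 3 \<and> coeff D 1 = coeff D 0"
    by (metis diff_conv_add_uminus smult_minus_left add.commute)+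
  then show ?thesis
    using parameter_unique_aux[of \<alpha> \<delta> \<beta> \<gamma> c c'] A(1) c unfolding N D
    by (simp add: numeral_eq_Suc)
qed

theorem theorem4p6:
  fixes R :: "'a::alg_closed_field poly fract"
  assumes "CHAR('a) = 2" and "rat_degree R = 3"
  shows "(rat_equiv R (rat_X ^ 3) \<or>
          rat_equiv R (rat_X ^ 3 + rat_X ^ 2) \<or>
          rat_equiv R ((rat_X ^ 3 + 1) / rat_X) \<or>
          (\<exists>c. c \<notin> {0, 1} \<and> rat_equiv R ((rat_X ^ 3 + rat_const c * rat_X ^ 2) / (rat_X + 1)))) \<and>
         (\<forall>c c'. c \<notin> {0, 1} \<longrightarrow> c' \<notin> {0, 1} \<longrightarrow>
            rat_equiv R ((rat_X ^ 3 + rat_const c * rat_X ^ 2) / (rat_X + 1)) \<longrightarrow>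
            rat_equiv R ((rat_X ^ 3 + rat_const c' * rat_X ^ 2) / (rat_X + 1)) \<longrightarrow> c = c')"
proof (intro conjI allI impI)
  have nc: "nonconst R" using assms(2) by (simp add: nonconst_iff_degree)
  show "rat_equiv R (rat_X ^ 3) \<or> rat_equiv R (rat_X ^ 3 + rat_X ^ 2) \<or>
      rat_equiv R ((rat_X ^ 3 + 1) / rat_X) \<or>
      (\<exists>c. c \<notin> {0, 1} \<and> rat_equiv R ((rat_X ^ 3 + rat_const c * rat_X ^ 2) / (rat_X + 1)))"
    using reducible_degree_3[OF assms]
    unfolding reducible_to_normal_form_def cubic_normal_form_def by blast
  fix c c' :: 'a
  assume c: "c \<notin> {0, 1}" "c' \<notin> {0, 1}"
    and *: "rat_equiv R (two_double_points c)" "rat_equiv R (two_double_points c')"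
  \<comment> \<open>The normal forms inherit degree three from \<open>R\<close> by invariance, so it
    need not be computed.\<close>
  have deg: "rat_degree (two_double_points c) = 3" "rat_degree (two_double_points c') = 3"
    using rat_equiv_degree[OF nc *(1)] rat_equiv_degree[OF nc *(2)] assms(2) by simp_all
  then have "nonconst (two_double_points c)" by (simp add: nonconst_iff_degree)
  then have "rat_equiv (two_double_points c) (two_double_points c')"
    using rat_equiv_trans[OF _ rat_equiv_sym[OF nc *(1)] *(2)] by blast
  then show "c = c'" using parameter_unique[OF assms(1)] c deg(2) by simp
qed

end
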